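(* In the setting described in the context, suppose that Algorithm A does not stop, so that it generates an infinite sequence $(x^k)_{k\in\mathbb{N}}$. Then $(x^k)_{k\in\mathbb{N}}$ converges to some element of $S_*\cap X$.
   Context: Setting. Let $n,m\ge 1$ be integers and $\mathbb{I}:=\{1,\dots,m\}$. For each $i\in\mathbb{I}$ let $A_i:\operatorname{dom}(A_i)\subset\mathbb{R}^n\to\mathbb{R}^n$ be a point-to-point (single-valued) maximal monotone operator and $B_i:\operatorname{dom}(B_i)\subset\mathbb{R}^n\to 2^{\mathbb{R}^n}$ a point-to-set maximal monotone operator, where $\operatorname{dom}(B_i)=\{x: B_i(x)\neq\emptyset\}$. (An operator is monotone if $\langle x-y,u-v\rangle\ge 0$ for all $(x,u),(y,v)$ in its graph, and maximal if its graph is not properly contained in the graph of another monotone operator on $\mathbb{R}^n$; the single-valued $A_i$ is identified with the set-valued operator that is empty outside $\operatorname{dom}(A_i)$.) Put $S_*^i:=\{x\in\mathbb{R}^n: 0\in A_i(x)+B_i(x)\}$ and $S_*:=\bigcap_{i\in\mathbb{I}}S_*^i$. $B[0,R]$ is the closed ball of center $0$ and radius $R$, and $P_C$ is the orthogonal projection onto a nonempty closed convex set $C$. Assumptions: (A1) $\operatorname{dom}(B_i)\subseteq\operatorname{dom}(A_i)$ for all $i\in\mathbb{I}$. (A2) $S_*\neq\emptyset$. (A3) For each bounded $V\subset\bigcap_{i=1}^m\operatorname{dom}(B_i)$ there is $R>0$ such that $B_i(x)\cap B[0,R]\neq\emptyset$ for all $x\in V$, $i\in\mathbb{I}$. Parameters: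 $X\subseteq\bigcap_{i\in\mathbb{I}}\operatorname{dom}(B_i)$ is nonempty, closed and convex with $X\cap S_*\ne\emptyset$; $(\beta_k)_{k\in\mathbb{N}}\subseteq[\check\beta,\hat\beta]$ with $0<\check\beta\le\hat\beta<\infty$; $\theta,\delta\in(0,1)$; $R>0$ is a fixed constant as in (A3), it being understood that all sets from which the algorithm below has to select vectors $u^k_{(j,i)}$ are nonempty. For $x\in\operatorname{dom}(A_i)$, $u\in\mathbb{R}^n$ let $H_i(x,u):=\{y\in\mathbb{R}^n:\langle A_i(x)+u,\,y-x\rangle\le 0\}$. Algorithm A. Take $x^0\in X$. Given $x^k$, set $z_1^k:=x^k$, $\mathbb{I}_k^*:=\emptyset$, and for $i=1,\dots,m$ do the following. Compute $J_i^k:=(I+\beta_kB_i)^{-1}(I-\beta_kA_i)(z_i^k)$. - If $z_i^k=J_i^k$, put $i$ into $\mathbb{I}_k^*$ and set $z_{i+1}^k:=z_i^k$. - Otherwise (inner loop), for $j=0,1,2,\dots$ choose any $u^k_{(j,i)}\in B_i(\theta^jJ_i^k+(1-\theta^j)z_i^k)\cap B[0,R]$, and let $j_i(k)$ be the first $j$ for which $$\big\langle A_i(\theta^jJ_i^k+(1-\theta^j)z_i^k)+u^k_{(j,i)},\,z_i^k-J_i^k\big\rangle\ge\frac{\delta}{\beta_k}\|z_i^k-J_i^k\|^2 .$$ Set $\alpha_{k,i}:=\theta^{j_i(k)}$, $\bar u_i^k:=u^k_{(j_i(k),i)}$, $\bar x_i^k:=\alpha_{k,i}J_i^k+(1-\alpha_{k,i})z_i^k$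 and $z_{i+1}^k:=P_X\big(P_{H_i(\bar x_i^k,\bar u_i^k)}(z_i^k)\big)$. If $\mathbb{I}_k^*=\mathbb{I}$, stop. Otherwise set $x^{k+1}:=z_{m+1}^k$ and continue with $k+1$. *)

theory Defs
  imports "HOL-Analysis.Analysis" "HOL-Library.Set_Algebras"
begin

text \<open>A point-to-set operator on a space is a function into sets.\<close>

definition op_graph :: "('a \<Rightarrow> 'a set) \<Rightarrow> ('a \<times> 'a) set" where
  "op_graph T = {(x, u). u \<in> T x}"

definition op_dom :: "('a \<Rightarrow> 'a set) \<Rightarrow> 'a set" where
  "op_dom T = {x. T x \<noteq> {}}"

definition monotone_op :: "('a::real_inner \<Rightarrow> 'a set) \<Rightarrow> bool" where
  "monotone_op T \<longleftrightarrow>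
     (\<forall>(x, u) \<in> op_graph T. \<forall>(y, v) \<in> op_graph T. (x - y) \<bullet> (u - v) \<ge> 0)"

definition maximal_monotone :: "('a::real_inner \<Rightarrow> 'a set) \<Rightarrow> bool" where
  "maximal_monotone T \<longleftrightarrow>
     monotone_op T \<and> \<not> (\<exists>T'. monotone_op T' \<and> op_graph T \<subset> op_graph T')"

text \<open>A point-to-point operator is given by its domain \<open>D\<close> and a total function \<open>f\<close>, whose
  values outside \<open>D\<close> are irrelevant. This is the set-valued operator it is identified with.\<close>

definition point_op :: "'a set \<Rightarrow> ('a \<Rightarrow> 'a) \<Rightarrow> 'a \<Rightarrow> 'a set" where
  "point_op D f x = (if x \<in> D then {f x} else {})"

text \<open>In the next definition, \<open>+\<close> is the Minkowski sum of sets.\<close>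

definition sol_set :: "('a::real_inner \<Rightarrow> 'a set) \<Rightarrow> ('a \<Rightarrow> 'a set) \<Rightarrow> 'a set" where
  "sol_set S T = {x. 0 \<in> S x + T x}"

definition common_sol_set ::
  "nat \<Rightarrow> (nat \<Rightarrow> 'a::real_inner \<Rightarrow> 'a set) \<Rightarrow> (nat \<Rightarrow> 'a \<Rightarrow> 'a set) \<Rightarrow> 'a set" where
  "common_sol_set m S T = (\<Inter>i\<in>{1..m}. sol_set (S i) (T i))"

text \<open>The value at \<open>y\<close> of the set-valued inverse of \<open>I + b T\<close>. For \<open>b > 0\<close> and \<open>T\<close> maximal
  monotone it has exactly one element, so that \<open>J \<in> resolvent b T y\<close> determines \<open>J\<close>.\<close>

definition resolvent :: "real \<Rightarrow> ('a::real_inner \<Rightarrow> 'a set) \<Rightarrow> 'a \<Rightarrow> 'a set" where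
  "resolvent b T y = {x. \<exists>v \<in> T x. y = x + b *\<^sub>R v}"

definition halfspace_H :: "('a::real_inner \<Rightarrow> 'a) \<Rightarrow> 'a \<Rightarrow> 'a \<Rightarrow> 'a set" where
  "halfspace_H f x u = {y. (f x + u) \<bullet> (y - x) \<le> 0}"

definition trial_point :: "real \<Rightarrow> 'a::real_inner \<Rightarrow> 'a \<Rightarrow> nat \<Rightarrow> 'a" where
  "trial_point \<theta> z J j = \<theta> ^ j *\<^sub>R J + (1 - \<theta> ^ j) *\<^sub>R z"

definition search_test ::
  "('a::real_inner \<Rightarrow> 'a) \<Rightarrow> real \<Rightarrow> real \<Rightarrow> real \<Rightarrow> 'a \<Rightarrow> 'a \<Rightarrow> (nat \<Rightarrow> 'a) \<Rightarrow> nat \<Rightarrow> bool" where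
  "search_test f b \<theta> \<delta> z J u j \<longleftrightarrow>
     (f (trial_point \<theta> z J j) + u j) \<bullet> (z - J) \<ge> \<delta> / b * (norm (z - J))\<^sup>2"

text \<open>The inner loop for a single index. A vector \<open>u j\<close> has to be selected exactly for those \<open>j\<close>
  that the loop reaches, i.e. for which the test has failed at all smaller indices; the other
  values of \<open>u\<close> are irrelevant. Termination of the loop is not part of the
  definition: if the test fails for all \<open>j\<close>, then all \<open>u j\<close> are selected and the \<open>LEAST\<close> is
  unspecified.\<close>

definition inner_loop ::
  "('a::euclidean_space \<Rightarrow> 'a) \<Rightarrow> ('a \<Rightarrow> 'a set) \<Rightarrow> 'a set \<Rightarrow> real \<Rightarrow> real \<Rightarrow> real \<Rightarrow> real \<Rightarrow>
     'a \<Rightarrow> 'a \<Rightarrow> (nat \<Rightarrow> 'a) \<Rightarrow> 'a \<Rightarrow> bool" where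
  "inner_loop f T X b \<theta> \<delta> R z J u z' \<longleftrightarrow>
     (\<forall>j. (\<forall>l<j. \<not> search_test f b \<theta> \<delta> z J u l) \<longrightarrow>
            u j \<in> T (trial_point \<theta> z J j) \<inter> cball 0 R) \<and>
     (let j = (LEAST j. search_test f b \<theta> \<delta> z J u j);
          xbar = trial_point \<theta> z J j
      in z' = closest_point X (closest_point (halfspace_H f xbar (u j)) z))"

text \<open>\<open>algorithm_A m A B X \<beta> \<theta> \<delta> R x z J u\<close> states that \<open>x\<close>, \<open>z\<close>, \<open>J\<close>, \<open>u\<close> are the data of an infinite
  run, where \<open>x k\<close> is the iterate $x^k$, and \<open>z k i\<close>, \<open>J k i\<close>, \<open>u k i j\<close> are
  $z_i^k$, $J_i^k$, $u^k_{(j,i)}$. That the stopping criterion is never met is a separate condition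
  in terms of \<open>stop_indices\<close>, the set $I_k^*$.\<close>

definition algorithm_A ::
  "nat \<Rightarrow> (nat \<Rightarrow> 'a::euclidean_space \<Rightarrow> 'a) \<Rightarrow> (nat \<Rightarrow> 'a \<Rightarrow> 'a set) \<Rightarrow> 'a set \<Rightarrow>
     (nat \<Rightarrow> real) \<Rightarrow> real \<Rightarrow> real \<Rightarrow> real \<Rightarrow>
     (nat \<Rightarrow> 'a) \<Rightarrow> (nat \<Rightarrow> nat \<Rightarrow> 'a) \<Rightarrow> (nat \<Rightarrow> nat \<Rightarrow> 'a) \<Rightarrow> (nat \<Rightarrow> nat \<Rightarrow> nat \<Rightarrow> 'a) \<Rightarrow> bool" where
  "algorithm_A m A B X \<beta> \<theta> \<delta> R x z J u \<longleftrightarrow>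
     x 0 \<in> X \<and>
     (\<forall>k. z k 1 = x k \<and>
          (\<forall>i\<in>{1..m}.
             J k i \<in> resolvent (\<beta> k) (B i) (z k i - \<beta> k *\<^sub>R A i (z k i)) \<and>
             (if z k i = J k i then z k (i + 1) = z k i
              else inner_loop (A i) (B i) X (\<beta> k) \<theta> \<delta> R (z k i) (J k i) (u k i) (z k (i + 1)))) \<and>
          x (k + 1) = z k (m + 1))"

definition stop_indices :: "nat \<Rightarrow> (nat \<Rightarrow> nat \<Rightarrow> 'a) \<Rightarrow> (nat \<Rightarrow> nat \<Rightarrow> 'a) \<Rightarrow> nat \<Rightarrow> nat set" where
  "stop_indices m z J k = {i \<in> {1..m}. z k i = J k i}"

end

theory Submission imports Defs begin

text \<open>Single-valuedness makes each \<open>A\<^sub>i\<close> continuous on its domain: if \<open>A\<^sub>i y\<^sub>n\<close> stayed away from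
  \<open>A\<^sub>i x\<close> while \<open>y\<^sub>n\<close> tends to \<open>x\<close>, a limit of points on the segments from \<open>A\<^sub>i x\<close> to \<open>A\<^sub>i y\<^sub>n\<close> would
  be a second value at \<open>x\<close> by maximality. Consequently the line search terminates, and every cut
  \<open>H\<^sub>i\<close> contains the common solutions, so the iterates are Fejer monotone and the distances from
  \<open>z\<^sub>i\<^sup>k\<close> to the cuts tend to \<open>0\<close>. At a limit point either the step sizes stay away from \<open>0\<close>, so that
  the depth of the cuts controls \<open>z - J\<close>, or they tend to \<open>0\<close>, and then the failed test for the
  previous trial point passes to the limit; in both cases \<open>z = J\<close> in the limit, so the limit
  point is a common solution, and Fejer monotonicity gives convergence of the whole sequence.\<close>

section \<open>Maximal monotone operators\<close>

lemma maximal_monotone_monoD: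
  assumes "maximal_monotone T" "u \<in> T x" "v \<in> T y"
  shows "(x - y) \<bullet> (u - v) \<ge> 0"
proof -
  have "monotone_op T" using assms(1) by (simp add: maximal_monotone_def)
  then show ?thesis using assms(2,3) by (auto simp: monotone_op_def op_graph_def)
qed

text \<open>Otherwise adding \<open>(x, u)\<close> to the graph would give a proper monotone
  extension.\<close>

lemma maximal_monotone_memI:
  assumes T: "maximal_monotone T"
    and ge: "\<And>y v. v \<in> T y \<Longrightarrow> (x - y) \<bullet> (u - v) \<ge> 0"
  shows "u \<in> T x"
proof (rule ccontr)
  assume u: "u \<notin> T x"
  define T' where "T' = T(x := insert u (T x))"
  have graph: "op_graph T' = insert (x, u) (op_graph T)"
    unfolding op_graph_def T'_def by (auto split: if_splits)
  have sym: "(y - x) \<bullet> (v - u) \<ge> 0" if "v \<in> T y" for y v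
    using ge[OF that] by (simp add: algebra_simps)
  have "(a - b) \<bullet> (v - w) \<ge> 0" if "(a, v) \<in> op_graph T'" "(b, w) \<in> op_graph T'" for a b v w
    using that ge[of w b] sym[of v a] maximal_monotone_monoD[OF T, of v a w b]
    by (auto simp: graph) (simp_all add: op_graph_def)
  then have "monotone_op T'" by (auto simp: monotone_op_def)
  moreover have "op_graph T \<subset> op_graph T'"
    using u graph by (auto simp: op_graph_def)
  ultimately show False
    using T unfolding maximal_monotone_def by blast
qed

text \<open>Each monotonicity inequality against a fixed graph point passes to the limit, and
  maximality turns the limit inequalities into membership.\<close>

lemma maximal_monotone_closed_graph:
  assumes T: "maximal_monotone T"
    and "\<And>n::nat. u n \<in> T (x n)" "x \<longlonglongrightarrow> x'" "u \<longlonglongrightarrow> u'"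
  shows "u' \<in> T x'"
proof (rule maximal_monotone_memI[OF T])
  fix y v assume v: "v \<in> T y"
  have "(\<lambda>n. (x n - y) \<bullet> (u n - v)) \<longlonglongrightarrow> (x' - y) \<bullet> (u' - v)"
    by (intro tendsto_intros assms)
  then show "(x' - y) \<bullet> (u' - v) \<ge> 0"
    by (rule LIMSEQ_le_const) (use maximal_monotone_monoD[OF T assms(2) v] in auto)
qed

lemma maximal_monotone_point_op_continuous_on:
  fixes f :: "'a::euclidean_space \<Rightarrow> 'a"
  assumes T: "maximal_monotone (point_op D f)"
  shows "continuous_on D f"
proof (rule ccontr)
  assume "\<not> continuous_on D f"
  then obtain x e where x: "x \<in> D" "e > 0"
    and far: "\<And>d. d > 0 \<Longrightarrow> \<exists>y\<in>D. dist y x < d \<and> dist (f y) (f x) \<ge> e"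
    unfolding continuous_on_iff not_less[symmetric] by blast
  have "\<exists>y. y \<in> D \<and> dist y x < inverse (real (Suc n)) \<and> e \<le> norm (f y - f x)" for n
    using far[of "inverse (real (Suc n))"] unfolding dist_norm[of "f _"]
    by (meson inverse_positive_iff_positive of_nat_0_less_iff zero_less_Suc)
  then obtain y where y: "\<And>n. y n \<in> D" "\<And>n. dist (y n) x < inverse (real (Suc n))"
    "\<And>n. e \<le> norm (f (y n) - f x)"
    by metis
  have "(\<lambda>n. dist (y n) x) \<longlonglongrightarrow> 0"
  proof (rule tendsto_sandwich[OF _ _ tendsto_const LIMSEQ_inverse_real_of_nat])
    show "\<forall>\<^sub>F n in sequentially. dist (y n) x \<le> inverse (real (Suc n))"
      using y(2) by (intro always_eventually allI less_imp_le)
  qed simp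
  then have ylim: "y \<longlonglongrightarrow> x" by (rule tendsto_dist_iff[THEN iffD2])
  \<comment> \<open>The values \<open>f (y n)\<close> may be unbounded, so only their directions
    from \<open>f x\<close> are kept. As \<open>e\<close> is at most their distance from
    \<open>f x\<close>, the point at distance \<open>e\<close> in direction \<open>w n\<close> lies
    on the segment to \<open>f (y n)\<close>.\<close>
  define w where "w n = sgn (f (y n) - f x)" for n
  have pos: "norm (f (y n) - f x) > 0" for n using y(3)[of n] x(2) by linarith
  have w1: "norm (w n) = 1" for n using pos[of n] by (auto simp: w_def norm_sgn)
  then have "\<forall>n. w n \<in> sphere 0 1" by simp
  then obtain w' r where r: "strict_mono (r :: nat \<Rightarrow> nat)" "(w \<circ> r) \<longlonglongrightarrow> w'" "w' \<in> sphere 0 1"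
    using compact_sphere[of "0::'a" 1] unfolding compact_def by blast
  \<comment> \<open>This is a second value at \<open>x\<close>, because \<open>w'\<close> is a unit
    vector and \<open>e > 0\<close>.\<close>
  have "f x + e *\<^sub>R w' \<in> point_op D f x"
  proof (rule maximal_monotone_memI[OF T])
    fix v q assume "q \<in> point_op D f v"
    then have v: "v \<in> D" "q = f v" by (auto simp: point_op_def split: if_splits)
    have mono: "(a - v) \<bullet> (f a - q) \<ge> 0" if "a \<in> D" for a
      using maximal_monotone_monoD[OF T, of "f a" a "f v" v] that v by (simp add: point_op_def)
    \<comment> \<open>Monotonicity at \<open>x\<close> and at \<open>y n\<close> is mixed with
      weights \<open>1 - t\<close> and \<open>t\<close>. The mismatch of the two base points costs
      only the right-hand side, which vanishes as \<open>y n\<close> tends to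
      \<open>x\<close>.\<close>
    have bd: "(y n - v) \<bullet> (f x + e *\<^sub>R w n - q) \<ge> - (norm (y n - x) * norm (f x - q))" for n
    proof -
      define t where "t = e / norm (f (y n) - f x)"
      have t: "0 \<le> t" "t \<le> 1" using x(2) y(3)[of n] pos[of n] by (auto simp: t_def)
      have eq: "e *\<^sub>R w n = t *\<^sub>R (f (y n) - f x)"
        by (simp add: w_def t_def sgn_div_norm divide_inverse)
      have "(y n - v) \<bullet> (f x + e *\<^sub>R w n - q) =
          (1 - t) * ((y n - x) \<bullet> (f x - q)) + (1 - t) * ((x - v) \<bullet> (f x - q))
            + t * ((y n - v) \<bullet> (f (y n) - q))"
        unfolding eq by (simp add: inner_diff_left inner_diff_right inner_add_right algebra_simps)
      moreover have "(1 - t) * ((x - v) \<bullet> (f x - q)) \<ge> 0" "t * ((y n - v) \<bullet> (f (y n) - q)) \<ge> 0"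
        using mono x(1) y(1) t by auto
      moreover have "(1 - t) * ((y n - x) \<bullet> (f x - q)) \<ge> - (norm (y n - x) * norm (f x - q))"
      proof -
        have "\<bar>(1 - t) * ((y n - x) \<bullet> (f x - q))\<bar> \<le> 1 * (norm (y n - x) * norm (f x - q))"
          unfolding abs_mult using t by (intro mult_mono Cauchy_Schwarz_ineq2) auto
        then show ?thesis by linarith
      qed
      ultimately show ?thesis by linarith
    qed
    have yr: "(\<lambda>n. y (r n)) \<longlonglongrightarrow> x"
      using LIMSEQ_subseq_LIMSEQ[OF ylim r(1)] by (simp add: o_def)
    have wr: "(\<lambda>n. w (r n)) \<longlonglongrightarrow> w'" using r(2) by (simp add: o_def)
    have "(\<lambda>n. (y (r n) - v) \<bullet> (f x + e *\<^sub>R w (r n) - q)) \<longlonglongrightarrow> (x - v) \<bullet> (f x + e *\<^sub>R w' - q)"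
      by (intro tendsto_intros yr wr)
    moreover have "(\<lambda>n. - (norm (y (r n) - x) * norm (f x - q))) \<longlonglongrightarrow> - (norm (x - x) * norm (f x - q))"
      by (intro tendsto_intros yr)
    ultimately show "(x - v) \<bullet> (f x + e *\<^sub>R w' - q) \<ge> 0"
      using LIMSEQ_le[of "\<lambda>n. - (norm (y (r n) - x) * norm (f x - q))"] bd by fastforce
  qed
  then show False
    using x r(3) by (auto simp: point_op_def)
qed

lemma mem_sol_set_point_op: "p \<in> sol_set (point_op D f) T \<longleftrightarrow> p \<in> D \<and> - f p \<in> T p"
proof
  assume "p \<in> sol_set (point_op D f) T"
  then obtain v where "p \<in> D" "v \<in> T p" "0 = f p + v"
    by (auto simp: sol_set_def point_op_def set_plus_def split: if_splits)
  moreover from this have "v = - f p" by (simp add: eq_neg_iff_add_eq_0 add.commute)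
  ultimately show "p \<in> D \<and> - f p \<in> T p" by simp
next
  assume "p \<in> D \<and> - f p \<in> T p"
  then show "p \<in> sol_set (point_op D f) T"
    by (auto simp: sol_set_def point_op_def set_plus_def intro!: bexI[of _ "- f p"])
qed

section \<open>The forward-backward step and the line search\<close>

text \<open>Unfolds the resolvent into a graph membership, to which monotonicity and the closed
  graph property apply.\<close>

lemma forward_backward_mem:
  assumes "J \<in> resolvent b T (z - b *\<^sub>R a)" "b > 0"
  shows "(1 / b) *\<^sub>R (z - J) - a \<in> T J"
proof -
  obtain v where v: "v \<in> T J" "z - b *\<^sub>R a = J + b *\<^sub>R v"
    using assms(1) by (auto simp: resolvent_def)
  then have "z - J = b *\<^sub>R (v + a)" by (simp add: algebra_simps)
  then have "(1 / b) *\<^sub>R (z - J) = v + a" using assms(2) by simp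
  then show ?thesis using v(1) by simp
qed

text \<open>This is monotonicity of \<open>T\<close> between \<open>J\<close> and \<open>z\<close>.
  The line search asks only for the smaller factor \<open>\<delta> / b\<close>, which leaves a gap
  to exploit in the limit.\<close>

lemma forward_backward_descent:
  assumes T: "maximal_monotone T" and v: "(1 / b) *\<^sub>R (z - J) - a \<in> T J" and u: "u \<in> T z"
  shows "(a + u) \<bullet> (z - J) \<ge> (1 / b) * (norm (z - J))\<^sup>2"
proof -
  have "(J - z) \<bullet> ((1 / b) *\<^sub>R (z - J) - a - u) \<ge> 0"
    by (rule maximal_monotone_monoD[OF T v u])
  moreover have "(J - z) \<bullet> ((1 / b) *\<^sub>R (z - J) - a - u)
      = (a + u) \<bullet> (z - J) - (1 / b) * ((z - J) \<bullet> (z - J))"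
    by (simp add: inner_diff_left inner_diff_right inner_add_left inner_add_right
        inner_commute algebra_simps)
  ultimately show ?thesis by (simp add: power2_norm_eq_inner)
qed

text \<open>A solution \<open>p\<close> is the resolvent value of its own forward step, so
  nonexpansiveness of the resolvent applies. The bound keeps \<open>J\<close> in a ball while
  \<open>z\<close>, \<open>f z\<close> and \<open>b\<close> stay bounded.\<close>

lemma forward_backward_bound:
  assumes T: "maximal_monotone T" and J: "J \<in> resolvent b T (z - b *\<^sub>R f z)" and b: "b > 0"
    and p: "- f p \<in> T p"
  shows "norm (J - p) \<le> norm (z - p) + b * norm (f z - f p)"
proof -
  let ?a = "(z - p) - b *\<^sub>R (f z - f p)"
  have "(J - p) \<bullet> (((1 / b) *\<^sub>R (z - J) - f z) - (- f p)) \<ge> 0"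
    by (rule maximal_monotone_monoD[OF T forward_backward_mem[OF J b] p])
  then have "b * ((J - p) \<bullet> (((1 / b) *\<^sub>R (z - J) - f z) - (- f p))) \<ge> 0" using b by simp
  moreover have "b *\<^sub>R (((1 / b) *\<^sub>R (z - J) - f z) - (- f p)) = ?a - (J - p)"
    using b by (simp add: algebra_simps)
  ultimately have "(J - p) \<bullet> (?a - (J - p)) \<ge> 0" by (metis inner_scaleR_right)
  then have "norm (J - p) * norm (J - p) \<le> (J - p) \<bullet> ?a"
    by (simp only: inner_diff_right[of "J - p" ?a] power2_norm_eq_inner[symmetric]
        power2_eq_square)
  also have "\<dots> \<le> norm (J - p) * norm ?a" by (rule norm_cauchy_schwarz)
  finally have "norm (J - p) \<le> norm ?a"
    by (cases "norm (J - p) = 0") (auto simp: mult_le_cancel_left)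
  also have "\<dots> \<le> norm (z - p) + b * norm (f z - f p)"
    using norm_triangle_ineq4[of "z - p" "b *\<^sub>R (f z - f p)"] b by simp
  finally show ?thesis .
qed

text \<open>In the limit, monotonicity bounds the tested quantity below with factor
  \<open>1 / b'\<close>, and the failed tests bound it above with \<open>\<delta> / b'\<close>; as
  \<open>\<delta> < 1\<close>, the norm of \<open>z' - J'\<close> must vanish. This serves both a
  single endless line search and the predecessors of step sizes tending to \<open>0\<close>.\<close>

lemma failed_search_limit:
  fixes f :: "'a::euclidean_space \<Rightarrow> 'a"
  assumes f: "continuous_on D f" and T: "maximal_monotone T" and dom: "op_dom T \<subseteq> D"
    and z: "z \<longlonglongrightarrow> z'" "\<And>n. z n \<in> D" "z' \<in> D" and J: "J \<longlonglongrightarrow> J'"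
    and b: "b \<longlonglongrightarrow> b'" "b' > 0" "\<And>n. b n > 0"
    and res: "\<And>n. J n \<in> resolvent (b n) T (z n - b n *\<^sub>R f (z n))"
    and y: "y \<longlonglongrightarrow> z'" "\<And>n. w n \<in> T (y n)" "w \<longlonglongrightarrow> w'"
    and fail: "\<forall>\<^sub>F n in sequentially.
        (f (y n) + w n) \<bullet> (z n - J n) \<le> \<delta> / b n * (norm (z n - J n))\<^sup>2"
    and \<delta>: "\<delta> < 1"
  shows "z' = J'"
proof -
  have fz: "(\<lambda>n. f (z n)) \<longlonglongrightarrow> f z'"
    by (rule continuous_on_tendsto_compose[OF f z(1) z(3)]) (simp add: z(2))
  have fy: "(\<lambda>n. f (y n)) \<longlonglongrightarrow> f z'"
    by (rule continuous_on_tendsto_compose[OF f y(1) z(3)])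
      (use y(2) dom in \<open>auto simp: op_dom_def intro!: always_eventually\<close>)
  have "(1 / b') *\<^sub>R (z' - J') - f z' \<in> T J'"
  proof (rule maximal_monotone_closed_graph[OF T])
    show "(1 / b n) *\<^sub>R (z n - J n) - f (z n) \<in> T (J n)" for n
      by (rule forward_backward_mem[OF res b(3)])
    show "(\<lambda>n. (1 / b n) *\<^sub>R (z n - J n) - f (z n)) \<longlonglongrightarrow> (1 / b') *\<^sub>R (z' - J') - f z'"
      using b(2) by (intro tendsto_intros z J b fz) simp
  qed (rule J)
  moreover have "w' \<in> T z'"
    by (rule maximal_monotone_closed_graph[OF T y(2,1,3)])
  ultimately have "(1 / b') * (norm (z' - J'))\<^sup>2 \<le> (f z' + w') \<bullet> (z' - J')"
    by (rule forward_backward_descent[OF T])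
  also have "\<dots> \<le> \<delta> / b' * (norm (z' - J'))\<^sup>2"
  proof (rule tendsto_le[OF sequentially_bot _ _ fail])
    show "(\<lambda>n. \<delta> / b n * (norm (z n - J n))\<^sup>2) \<longlonglongrightarrow> \<delta> / b' * (norm (z' - J'))\<^sup>2"
      using b(2) by (intro tendsto_intros z J b) simp
    show "(\<lambda>n. (f (y n) + w n) \<bullet> (z n - J n)) \<longlonglongrightarrow> (f z' + w') \<bullet> (z' - J')"
      by (intro tendsto_intros z J y fy)
  qed
  finally have "(1 - \<delta>) * (norm (z' - J'))\<^sup>2 \<le> 0"
    using b(2) by (simp add: field_simps)
  then show ?thesis using \<delta> by (simp add: mult_le_0_iff)
qed

lemma trial_point_tendsto:
  assumes "z \<longlonglongrightarrow> z'" "J \<longlonglongrightarrow> J'" "(\<lambda>n. \<theta> ^ j n) \<longlonglongrightarrow> a"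
  shows "(\<lambda>n. trial_point \<theta> (z n) (J n) (j n)) \<longlonglongrightarrow> a *\<^sub>R J' + (1 - a) *\<^sub>R z'"
  unfolding trial_point_def by (intro tendsto_intros assms)

text \<open>If every test failed, all vectors would be selected inside the ball, so a subsequence
  converges while the trial points tend to \<open>z\<close>; \<open>failed_search_limit\<close> then
  forces \<open>z = J\<close>.\<close>

lemma line_search_terminates:
  fixes f :: "'a::euclidean_space \<Rightarrow> 'a"
  assumes f: "continuous_on D f" and T: "maximal_monotone T" and dom: "op_dom T \<subseteq> D"
    and z: "z \<in> D" "z \<noteq> J" and b: "b > 0"
    and res: "J \<in> resolvent b T (z - b *\<^sub>R f z)"
    and par: "\<theta> \<in> {0<..<1}" "\<delta> < 1"
    and u: "\<And>j. (\<forall>l<j. \<not> search_test f b \<theta> \<delta> z J u l) \<Longrightarrow>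
            u j \<in> T (trial_point \<theta> z J j) \<inter> cball 0 R"
  shows "\<exists>j. search_test f b \<theta> \<delta> z J u j"
proof (rule ccontr)
  assume no: "\<nexists>j. search_test f b \<theta> \<delta> z J u j"
  then have u: "u j \<in> T (trial_point \<theta> z J j)" "u j \<in> cball 0 R" for j
    using u[of j] by auto
  then obtain u' r where r: "strict_mono (r :: nat \<Rightarrow> nat)" "(u \<circ> r) \<longlonglongrightarrow> u'"
    using compact_cball[of "0::'a" R] unfolding compact_def by metis
  have "(\<lambda>n. \<theta> ^ r n) \<longlonglongrightarrow> 0"
    using LIMSEQ_subseq_LIMSEQ[OF LIMSEQ_realpow_zero r(1), of \<theta>] par by (simp add: o_def)
  from trial_point_tendsto[OF tendsto_const tendsto_const this, of z J]
  have y: "(\<lambda>n. trial_point \<theta> z J (r n)) \<longlonglongrightarrow> z" by simp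
  have "z = J"
  \<comment> \<open>Here \<open>z\<close>, \<open>J\<close> and \<open>b\<close> are constant
    sequences; only the trial points and the selected vectors vary with \<open>n\<close>.\<close>
  proof (rule failed_search_limit[OF f T dom tendsto_const _ _ tendsto_const tendsto_const])
    show "(\<lambda>n. u (r n)) \<longlonglongrightarrow> u'" using r(2) by (simp add: o_def)
    show "\<forall>\<^sub>F n in sequentially. (f (trial_point \<theta> z J (r n)) + u (r n)) \<bullet> (z - J)
        \<le> \<delta> / b * (norm (z - J))\<^sup>2"
      using no by (auto simp: search_test_def not_le less_imp_le)
  qed (use z b res y u par in auto)
  then show False using z by simp
qed

section \<open>Cuts produced by the line search and their limits\<close>

text \<open>\<open>d\<close> stands for the distance from \<open>z\<close> to the half-space. The
  last clause bounds the depth of \<open>z\<close> in the cut, in product form to avoid dividing by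
  the norm of the normal vector. Vectors are recorded for all \<open>l \<le> j\<close> because the
  limit argument also uses the one at \<open>j - 1\<close>.\<close>

definition separating_cut ::
  "('a::euclidean_space \<Rightarrow> 'a) \<Rightarrow> ('a \<Rightarrow> 'a set) \<Rightarrow> real \<Rightarrow> real \<Rightarrow> real \<Rightarrow> real \<Rightarrow>
     'a \<Rightarrow> 'a \<Rightarrow> (nat \<Rightarrow> 'a) \<Rightarrow> nat \<Rightarrow> real \<Rightarrow> bool" where
  "separating_cut f T b \<theta> \<delta> R z J u j d \<longleftrightarrow>
     search_test f b \<theta> \<delta> z J u j \<and> (\<forall>l<j. \<not> search_test f b \<theta> \<delta> z J u l) \<and>
     (\<forall>l\<le>j. u l \<in> T (trial_point \<theta> z J l) \<inter> cball 0 R) \<and>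
     (f (trial_point \<theta> z J j) + u j) \<bullet> (z - trial_point \<theta> z J j)
       \<le> norm (f (trial_point \<theta> z J j) + u j) * d"

text \<open>Along a subsequence the step sizes converge to some \<open>a\<close>. If
  \<open>a > 0\<close>, the depth of the cuts, which tends to \<open>0\<close> with
  \<open>d\<close>, forces \<open>z' = J'\<close>; if \<open>a = 0\<close>, the failed tests at the
  preceding indices do so.\<close>

lemma separating_cut_limit:
  fixes f :: "'a::euclidean_space \<Rightarrow> 'a"
  assumes f: "continuous_on D f" and T: "maximal_monotone T" and dom: "op_dom T \<subseteq> D"
    and z: "z \<longlonglongrightarrow> z'" "\<And>n. z n \<in> D" "z' \<in> D" and J: "J \<longlonglongrightarrow> J'"
    and b: "b \<longlonglongrightarrow> b'" "b' > 0" "\<And>n. b n > 0"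
    and res: "\<And>n. J n \<in> resolvent (b n) T (z n - b n *\<^sub>R f (z n))"
    and par: "\<theta> \<in> {0<..<1}" "\<delta> \<in> {0<..<1}"
    and cut: "\<And>n. separating_cut f T (b n) \<theta> \<delta> R (z n) (J n) (u n) (j n) (d n)"
    and d: "d \<longlonglongrightarrow> 0"
  shows "z' = J'"
proof (rule ccontr)
  assume ne: "z' \<noteq> J'"
  \<comment> \<open>If \<open>j n = 0\<close>, the truncated predecessor is \<open>0\<close>, whose vector is selected as well.\<close>
  define s where "s n = (\<theta> ^ j n, u n (j n), u n (j n - 1))" for n
  have u: "u n l \<in> T (trial_point \<theta> (z n) (J n) l)" "u n l \<in> cball 0 R" if "l \<le> j n" for n l
    using cut[of n] that by (auto simp: separating_cut_def)
  have "compact ({0..1::real} \<times> cball (0::'a) R \<times> cball (0::'a) R)"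
    by (intro compact_Times compact_cball compact_Icc)
  moreover have "s n \<in> {0..1} \<times> cball 0 R \<times> cball 0 R" for n
    using u(2)[of "j n" n] u(2)[of "j n - 1" n] par by (auto simp: s_def power_le_one)
  ultimately obtain s' r where r: "strict_mono (r :: nat \<Rightarrow> nat)" "(s \<circ> r) \<longlonglongrightarrow> s'"
    unfolding compact_def by metis
  obtain a ub up where s': "s' = (a, ub, up)" by (cases s')
  have lim: "(\<lambda>n. \<theta> ^ j (r n)) \<longlonglongrightarrow> a" "(\<lambda>n. u (r n) (j (r n))) \<longlonglongrightarrow> ub"
    "(\<lambda>n. u (r n) (j (r n) - 1)) \<longlonglongrightarrow> up"
    using tendsto_fst[OF r(2)] tendsto_fst[OF tendsto_snd[OF r(2)]]
      tendsto_snd[OF tendsto_snd[OF r(2)]] by (simp_all add: s_def s' o_def)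
  have zr: "(\<lambda>n. z (r n)) \<longlonglongrightarrow> z'" and Jr: "(\<lambda>n. J (r n)) \<longlonglongrightarrow> J'" and br: "(\<lambda>n. b (r n)) \<longlonglongrightarrow> b'"
    and dr: "(\<lambda>n. d (r n)) \<longlonglongrightarrow> 0"
    using LIMSEQ_subseq_LIMSEQ[OF _ r(1)] z(1) J b(1) d by (auto simp: o_def)
  define y where "y n = trial_point \<theta> (z (r n)) (J (r n)) (j (r n))" for n
  define y' where "y' = a *\<^sub>R J' + (1 - a) *\<^sub>R z'"
  define g where "g n = f (y n) + u (r n) (j (r n))" for n
  have y: "y \<longlonglongrightarrow> y'"
    unfolding y_def y'_def by (rule trial_point_tendsto[OF zr Jr lim(1)])
  have uy: "u (r n) (j (r n)) \<in> T (y n)" for n using u(1) by (simp add: y_def)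
  \<comment> \<open>\<open>y'\<close> may differ from \<open>z'\<close>, so continuity of
    \<open>f\<close> there requires \<open>y'\<close> to be in \<open>D\<close>. The closed graph
    places it in the domain of \<open>T\<close>.\<close>
  have "ub \<in> T y'"
    by (rule maximal_monotone_closed_graph[OF T uy y lim(2)])
  then have "y' \<in> D" using dom by (auto simp: op_dom_def)
  then have fy: "(\<lambda>n. f (y n)) \<longlonglongrightarrow> f y'"
    by (rule continuous_on_tendsto_compose[OF f y]) (use uy dom in \<open>auto simp: op_dom_def intro!: always_eventually\<close>)
  \<comment> \<open>The displacement from the trial point to \<open>z\<close> is the step size times
    \<open>z - J\<close>, so the depth of the cut is the step size times the tested quantity, which
    the successful test bounds below.\<close>
  have "\<theta> ^ j (r n) * (\<delta> / b (r n) * (norm (z (r n) - J (r n)))\<^sup>2) \<le> norm (g n) * d (r n)" for n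
  proof -
    have "z (r n) - y n = \<theta> ^ j (r n) *\<^sub>R (z (r n) - J (r n))"
      by (simp add: y_def trial_point_def algebra_simps)
    then have "\<theta> ^ j (r n) * (g n \<bullet> (z (r n) - J (r n))) \<le> norm (g n) * d (r n)"
      using cut[of "r n"] by (simp add: separating_cut_def y_def g_def)
    moreover have "\<delta> / b (r n) * (norm (z (r n) - J (r n)))\<^sup>2 \<le> g n \<bullet> (z (r n) - J (r n))"
      using cut[of "r n"] by (simp add: separating_cut_def search_test_def y_def g_def)
    then have "\<theta> ^ j (r n) * (\<delta> / b (r n) * (norm (z (r n) - J (r n)))\<^sup>2)
        \<le> \<theta> ^ j (r n) * (g n \<bullet> (z (r n) - J (r n)))"
      using par by (intro mult_left_mono) auto
    ultimately show ?thesis by linarith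
  qed
  moreover have "(\<lambda>n. \<theta> ^ j (r n) * (\<delta> / b (r n) * (norm (z (r n) - J (r n)))\<^sup>2))
      \<longlonglongrightarrow> a * (\<delta> / b' * (norm (z' - J'))\<^sup>2)"
    using b(2) by (intro tendsto_intros lim br zr Jr) simp
  moreover have "(\<lambda>n. norm (g n) * d (r n)) \<longlonglongrightarrow> norm (f y' + ub) * 0"
    unfolding g_def by (intro tendsto_intros fy lim dr)
  ultimately have "a * (\<delta> / b' * (norm (z' - J'))\<^sup>2) \<le> 0"
    using LIMSEQ_le by fastforce
  moreover have "\<delta> / b' * (norm (z' - J'))\<^sup>2 > 0" using ne par b(2) by simp
  ultimately have "a \<le> 0" by (meson mult_pos_pos not_le)
  moreover have "a \<ge> 0"
    by (rule LIMSEQ_le_const[OF lim(1)]) (use par in auto)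
  ultimately have a: "a = 0" by simp
  have "\<forall>\<^sub>F n in sequentially. \<theta> ^ j (r n) < 1"
    using order_tendstoD(2)[OF lim(1)[unfolded a], of 1] by simp
  \<comment> \<open>Vanishing step sizes exclude \<open>j = 0\<close>, so eventually
    \<open>j - 1\<close> is a genuine predecessor: its test failed, and its step size, larger only
    by the factor \<open>1 / \<theta>\<close>, still tends to \<open>0\<close>.\<close>
  then have jpos: "\<forall>\<^sub>F n in sequentially. 0 < j (r n)"
    by (rule eventually_mono) (use gr0I in fastforce)
  have "(\<lambda>n. \<theta> ^ j (r n) / \<theta>) \<longlonglongrightarrow> 0 / \<theta>"
    using par by (intro tendsto_intros lim(1)[unfolded a]) simp
  then have "(\<lambda>n. \<theta> ^ (j (r n) - 1)) \<longlonglongrightarrow> 0"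
    unfolding div_0
  proof (rule Lim_transform_eventually)
    show "\<forall>\<^sub>F n in sequentially. \<theta> ^ j (r n) / \<theta> = \<theta> ^ (j (r n) - 1)"
      using jpos by (rule eventually_mono) (use par in \<open>auto simp: power_diff\<close>)
  qed
  from trial_point_tendsto[OF zr Jr this]
  have yp: "(\<lambda>n. trial_point \<theta> (z (r n)) (J (r n)) (j (r n) - 1)) \<longlonglongrightarrow> z'" by simp
  have "z' = J'"
  proof (rule failed_search_limit[OF f T dom zr _ _ Jr br])
    show "\<forall>\<^sub>F n in sequentially.
        (f (trial_point \<theta> (z (r n)) (J (r n)) (j (r n) - 1)) + u (r n) (j (r n) - 1))
          \<bullet> (z (r n) - J (r n)) \<le> \<delta> / b (r n) * (norm (z (r n) - J (r n)))\<^sup>2"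
      using jpos
    proof (rule eventually_mono)
      fix n assume "0 < j (r n)"
      then have "\<not> search_test f (b (r n)) \<theta> \<delta> (z (r n)) (J (r n)) (u (r n)) (j (r n) - 1)"
        using cut[of "r n"] by (simp add: separating_cut_def)
      then show "(f (trial_point \<theta> (z (r n)) (J (r n)) (j (r n) - 1)) + u (r n) (j (r n) - 1))
          \<bullet> (z (r n) - J (r n)) \<le> \<delta> / b (r n) * (norm (z (r n) - J (r n)))\<^sup>2"
        by (simp add: search_test_def)
    qed
  qed (use z b res yp u(1) lim(3) par in auto)
  then show False using ne by simp
qed

section \<open>Fejer monotonicity\<close>

text \<open>Add the monotonicity inequalities of both operators between \<open>y\<close> and
  \<open>p\<close>, using the value \<open>- f p\<close> of \<open>T\<close> at \<open>p\<close>;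
  the terms with \<open>f p\<close> cancel.\<close>

lemma sol_mem_halfspace:
  assumes A: "maximal_monotone (point_op D f)" and T: "maximal_monotone T" and dom: "op_dom T \<subseteq> D"
    and p: "p \<in> sol_set (point_op D f) T" and u: "u \<in> T y"
  shows "p \<in> halfspace_H f y u"
proof -
  have p: "p \<in> D" "- f p \<in> T p" using p by (auto simp: mem_sol_set_point_op)
  have "y \<in> D" using u dom by (auto simp: op_dom_def)
  then have "(y - p) \<bullet> (f y - f p) \<ge> 0"
    using maximal_monotone_monoD[OF A] p by (simp add: point_op_def)
  moreover have "(y - p) \<bullet> (u - - f p) \<ge> 0"
    by (rule maximal_monotone_monoD[OF T u p(2)])
  ultimately show ?thesis
    by (simp add: halfspace_H_def inner_diff_left inner_diff_right inner_add_left inner_add_right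
        inner_commute algebra_simps)
qed

lemma halfspace_H_closed_convex: "closed (halfspace_H f y u)" "convex (halfspace_H f y u)"
proof -
  have "halfspace_H f y u = {x. (f y + u) \<bullet> x \<le> (f y + u) \<bullet> y}"
    by (auto simp: halfspace_H_def inner_diff_right)
  then show "closed (halfspace_H f y u)" "convex (halfspace_H f y u)"
    by (auto intro: closed_halfspace_le convex_halfspace_le)
qed

lemma closest_point_pythagoras:
  fixes z :: "'a::euclidean_space"
  assumes "closed S" "convex S" "p \<in> S"
  shows "(norm (closest_point S z - p))\<^sup>2 \<le> (norm (z - p))\<^sup>2 - (norm (z - closest_point S z))\<^sup>2"
proof -
  let ?c = "closest_point S z"
  have "(z - ?c) \<bullet> (p - ?c) \<le> 0" by (rule closest_point_dot[OF assms(2,1,3)])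
  moreover have "(norm (z - p))\<^sup>2 =
      (norm (z - ?c))\<^sup>2 + (norm (?c - p))\<^sup>2 - 2 * ((z - ?c) \<bullet> (p - ?c))"
    by (simp add: power2_norm_eq_inner inner_diff_left inner_diff_right inner_commute algebra_simps)
  ultimately show ?thesis by linarith
qed

text \<open>The witness for \<open>d\<close> is the distance \<open>norm (z - c)\<close> from
  \<open>z\<close> to the half-space. Projecting onto the half-space gains its square, and
  projecting onto \<open>X\<close> afterwards loses nothing with respect to points of
  \<open>X\<close>.\<close>

lemma inner_loop_separating_cut:
  fixes f :: "'a::euclidean_space \<Rightarrow> 'a"
  assumes A: "maximal_monotone (point_op D f)" and T: "maximal_monotone T" and dom: "op_dom T \<subseteq> D"
    and X: "closed X" "convex X" "X \<subseteq> op_dom T"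
    and z: "z \<in> X" "z \<noteq> J" and b: "b > 0"
    and res: "J \<in> resolvent b T (z - b *\<^sub>R f z)"
    and par: "\<theta> \<in> {0<..<1}" "\<delta> < 1"
    and ne: "X \<inter> sol_set (point_op D f) T \<noteq> {}"
    and loop: "inner_loop f T X b \<theta> \<delta> R z J u z'"
  shows "z' \<in> X \<and> (\<exists>d. norm (z' - z) \<le> d \<and>
      (\<forall>p \<in> X \<inter> sol_set (point_op D f) T. (norm (z' - p))\<^sup>2 \<le> (norm (z - p))\<^sup>2 - d\<^sup>2) \<and>
      (\<exists>j. separating_cut f T b \<theta> \<delta> R z J u j d))"
proof -
  define j where "j = (LEAST j. search_test f b \<theta> \<delta> z J u j)"
  define y where "y = trial_point \<theta> z J j"
  define H where "H = halfspace_H f y (u j)"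
  define c where "c = closest_point H z"
  have sel: "u l \<in> T (trial_point \<theta> z J l) \<inter> cball 0 R"
    if "\<forall>i<l. \<not> search_test f b \<theta> \<delta> z J u i" for l
    using loop that unfolding inner_loop_def by blast
  have z': "z' = closest_point X c"
    using loop by (simp add: inner_loop_def Let_def j_def y_def H_def c_def)
  have zD: "z \<in> D" using z(1) X(3) dom by auto
  have ex: "\<exists>j. search_test f b \<theta> \<delta> z J u j"
    by (rule line_search_terminates[OF maximal_monotone_point_op_continuous_on[OF A] T dom
        zD z(2) b res par sel])
  have test: "search_test f b \<theta> \<delta> z J u j" and fail: "\<And>l. l < j \<Longrightarrow> \<not> search_test f b \<theta> \<delta> z J u l"
    unfolding j_def using LeastI_ex[OF ex] not_less_Least by auto
  have u: "u l \<in> T (trial_point \<theta> z J l) \<inter> cball 0 R" if "l \<le> j" for l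
    using sel[of l] fail that by auto
  have sol: "p \<in> H" if "p \<in> sol_set (point_op D f) T" for p
    unfolding H_def by (rule sol_mem_halfspace[OF A T dom that]) (use u[of j] in \<open>simp add: y_def\<close>)
  have H: "closed H" "convex H" "H \<noteq> {}"
    using ne sol by (auto simp: H_def halfspace_H_closed_convex)
  have X0: "X \<noteq> {}" using z(1) by auto
  \<comment> \<open>The projection onto \<open>X\<close> is nonexpansive and fixes \<open>p\<close>.
    Taking \<open>p = z\<close> bounds the step length; taking a solution gives the Fejer
    inequality.\<close>
  have nonexp: "norm (z' - p) \<le> norm (c - p)" if "p \<in> X" for p
    using closest_point_lipschitz[OF X(2,1) X0, of c p] closest_point_self[OF that] z'
    by (simp add: dist_norm)
  have "z' \<in> X" unfolding z' by (rule closest_point_in_set[OF X(1) X0])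
  moreover have "norm (z' - z) \<le> norm (z - c)"
    using nonexp[OF z(1)] by (simp add: norm_minus_commute)
  moreover have "(norm (z' - p))\<^sup>2 \<le> (norm (z - p))\<^sup>2 - (norm (z - c))\<^sup>2"
    if "p \<in> X \<inter> sol_set (point_op D f) T" for p
  proof -
    have "(norm (z' - p))\<^sup>2 \<le> (norm (c - p))\<^sup>2" using nonexp[of p] that by (simp add: power_mono)
    also have "\<dots> \<le> (norm (z - p))\<^sup>2 - (norm (z - c))\<^sup>2"
      unfolding c_def using closest_point_pythagoras[OF H(1,2)] sol that by auto
    finally show ?thesis .
  qed
  moreover have "(f y + u j) \<bullet> (z - y) \<le> norm (f y + u j) * norm (z - c)"
  proof -
    have "c \<in> H" unfolding c_def by (rule closest_point_in_set[OF H(1,3)])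
    then have "(f y + u j) \<bullet> (c - y) \<le> 0" by (simp add: H_def halfspace_H_def)
    then have "(f y + u j) \<bullet> (z - y) \<le> (f y + u j) \<bullet> (z - c)"
      by (simp add: inner_diff_right)
    also have "\<dots> \<le> norm (f y + u j) * norm (z - c)" by (rule norm_cauchy_schwarz)
    finally show ?thesis .
  qed
  then have "separating_cut f T b \<theta> \<delta> R z J u j (norm (z - c))"
    using test fail u by (simp add: separating_cut_def y_def)
  ultimately show ?thesis by blast
qed

section \<open>Cluster points are solutions\<close>

text \<open>Boundedness of \<open>J\<close> and \<open>b\<close> gives limits \<open>J'\<close> and
  \<open>b'\<close> along a subsequence. If \<open>z' \<noteq> J'\<close>, cuts exist at all late
  indices and \<open>separating_cut_limit\<close> is contradicted; with \<open>z' = J'\<close> the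
  limiting forward-backward inclusion reads \<open>- f z' \<in> T z'\<close>.\<close>

lemma cluster_point_mem_sol_set:
  fixes f :: "'a::euclidean_space \<Rightarrow> 'a"
  assumes A: "maximal_monotone (point_op D f)" and T: "maximal_monotone T" and dom: "op_dom T \<subseteq> D"
    and z: "z \<longlonglongrightarrow> z'" "\<And>n. z n \<in> D" "z' \<in> D"
    and b: "0 < bl" "\<And>n. b n \<in> {bl..bu}"
    and res: "\<And>n. J n \<in> resolvent (b n) T (z n - b n *\<^sub>R f (z n))"
    and par: "\<theta> \<in> {0<..<1}" "\<delta> \<in> {0<..<1}"
    and p: "p \<in> sol_set (point_op D f) T"
    and cut: "\<And>n. z n \<noteq> J n \<Longrightarrow> \<exists>j. separating_cut f T (b n) \<theta> \<delta> R (z n) (J n) (u n) j (d n)"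
    and d: "d \<longlonglongrightarrow> 0"
  shows "z' \<in> sol_set (point_op D f) T"
proof -
  have f: "continuous_on D f" by (rule maximal_monotone_point_op_continuous_on[OF A])
  have bpos: "b n > 0" for n using b(1) b(2)[of n] by simp
  have fz: "(\<lambda>n. f (z n)) \<longlonglongrightarrow> f z'"
    by (rule continuous_on_tendsto_compose[OF f z(1) z(3)]) (simp add: z(2))
  have pT: "- f p \<in> T p" using p by (simp add: mem_sol_set_point_op)
  have "(\<lambda>n. norm (z n - p) + bu * norm (f (z n) - f p)) \<longlonglongrightarrow> norm (z' - p) + bu * norm (f z' - f p)"
    by (intro tendsto_intros z fz)
  then have "bounded (range (\<lambda>n. norm (z n - p) + bu * norm (f (z n) - f p)))"
    by (rule convergent_imp_bounded)
  then obtain C where "\<And>n. norm (norm (z n - p) + bu * norm (f (z n) - f p)) \<le> C"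
    unfolding bounded_iff by auto
  then have C: "norm (z n - p) + bu * norm (f (z n) - f p) \<le> C" for n
    by (metis abs_le_D1 real_norm_def)
  have JC: "J n \<in> cball p C" for n
  proof -
    have "norm (J n - p) \<le> norm (z n - p) + b n * norm (f (z n) - f p)"
      by (rule forward_backward_bound[OF T res bpos pT])
    also have "\<dots> \<le> norm (z n - p) + bu * norm (f (z n) - f p)"
      using b(2)[of n] by (intro add_left_mono mult_right_mono) auto
    finally show ?thesis using C[of n] by (simp add: dist_norm norm_minus_commute)
  qed
  have "compact (cball p C \<times> {bl..bu})" by (intro compact_Times compact_cball compact_Icc)
  moreover have "(J n, b n) \<in> cball p C \<times> {bl..bu}" for n using JC b(2) by auto
  ultimately obtain s' r where r: "strict_mono (r :: nat \<Rightarrow> nat)" "s' \<in> cball p C \<times> {bl..bu}"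
      "((\<lambda>n. (J n, b n)) \<circ> r) \<longlonglongrightarrow> s'"
    unfolding compact_def by (metis (no_types, lifting))
  obtain J' b' where s': "s' = (J', b')" by (cases s')
  have Jr: "(\<lambda>n. J (r n)) \<longlonglongrightarrow> J'" and br: "(\<lambda>n. b (r n)) \<longlonglongrightarrow> b'"
    using tendsto_fst[OF r(3)] tendsto_snd[OF r(3)] by (simp_all add: s' o_def)
  have b': "b' > 0" using r(2) s' b(1) by auto
  have zr: "(\<lambda>n. z (r n)) \<longlonglongrightarrow> z'" and dr: "(\<lambda>n. d (r n)) \<longlonglongrightarrow> 0" and fzr: "(\<lambda>n. f (z (r n))) \<longlonglongrightarrow> f z'"
    using LIMSEQ_subseq_LIMSEQ[OF _ r(1)] z(1) d fz by (auto simp: o_def)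
  have "z' = J'"
  proof (rule ccontr)
    assume "z' \<noteq> J'"
    moreover have "(\<lambda>n. z (r n) - J (r n)) \<longlonglongrightarrow> z' - J'" by (intro tendsto_intros zr Jr)
    ultimately have "\<forall>\<^sub>F n in sequentially. z (r n) - J (r n) \<noteq> 0"
      by (intro tendsto_imp_eventually_ne) auto
    then obtain N where N: "\<And>n. n \<ge> N \<Longrightarrow> z (r n) \<noteq> J (r n)"
      by (auto simp: eventually_sequentially)
    \<comment> \<open>Skipping the first \<open>N\<close> terms makes a cut available at every
      index.\<close>
    define q where "q n = r (n + N)" for n
    have "\<forall>n. \<exists>j. separating_cut f T (b (q n)) \<theta> \<delta> R (z (q n)) (J (q n)) (u (q n)) j (d (q n))"
      using cut N by (simp add: q_def)
    then obtain j where j: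
      "\<And>n. separating_cut f T (b (q n)) \<theta> \<delta> R (z (q n)) (J (q n)) (u (q n)) (j n) (d (q n))"
      by metis
    have "(\<lambda>n. z (q n)) \<longlonglongrightarrow> z'" "(\<lambda>n. J (q n)) \<longlonglongrightarrow> J'" "(\<lambda>n. b (q n)) \<longlonglongrightarrow> b'" "(\<lambda>n. d (q n)) \<longlonglongrightarrow> 0"
      unfolding q_def using zr Jr br dr by (auto intro: LIMSEQ_ignore_initial_segment)
    from separating_cut_limit[OF f T dom this(1) z(2,3) this(2,3) b' bpos res par j this(4)]
    show False using \<open>z' \<noteq> J'\<close> by simp
  qed
  have "(1 / b') *\<^sub>R (z' - J') - f z' \<in> T J'"
  proof (rule maximal_monotone_closed_graph[OF T])
    show "(1 / b (r n)) *\<^sub>R (z (r n) - J (r n)) - f (z (r n)) \<in> T (J (r n))" for n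
      by (rule forward_backward_mem[OF res bpos])
    show "(\<lambda>n. (1 / b (r n)) *\<^sub>R (z (r n) - J (r n)) - f (z (r n)))
        \<longlonglongrightarrow> (1 / b') *\<^sub>R (z' - J') - f z'"
      using b' by (intro tendsto_intros zr Jr br fzr) simp
  qed (rule Jr)
  then show ?thesis using \<open>z' = J'\<close> z(3) by (simp add: mem_sol_set_point_op)
qed

section \<open>Convergence of the whole sequence\<close>

theorem theorem4p8:
  fixes m :: nat
    and D :: "nat \<Rightarrow> (real ^ 'n) set"
    and A :: "nat \<Rightarrow> real ^ 'n \<Rightarrow> real ^ 'n"
    and B :: "nat \<Rightarrow> real ^ 'n \<Rightarrow> (real ^ 'n) set"
    and X :: "(real ^ 'n) set"
    and \<beta> :: "nat \<Rightarrow> real" and \<beta>min \<beta>max \<theta> \<delta> R :: real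
    and x :: "nat \<Rightarrow> real ^ 'n"
    and z J :: "nat \<Rightarrow> nat \<Rightarrow> real ^ 'n"
    and u :: "nat \<Rightarrow> nat \<Rightarrow> nat \<Rightarrow> real ^ 'n"
  assumes "m \<ge> 1"
    and "\<And>i. i \<in> {1..m} \<Longrightarrow> maximal_monotone (point_op (D i) (A i))"
    and "\<And>i. i \<in> {1..m} \<Longrightarrow> maximal_monotone (B i)"
    and A1: "\<And>i. i \<in> {1..m} \<Longrightarrow> op_dom (B i) \<subseteq> D i"
    and A2: "common_sol_set m (\<lambda>i. point_op (D i) (A i)) B \<noteq> {}"
    and A3: "\<And>V. bounded V \<Longrightarrow> V \<subseteq> (\<Inter>i\<in>{1..m}. op_dom (B i)) \<Longrightarrow>
               \<exists>r>0. \<forall>y\<in>V. \<forall>i\<in>{1..m}. B i y \<inter> cball 0 r \<noteq> {}"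
    and "X \<noteq> {}" and "closed X" and "convex X"
    and "X \<subseteq> (\<Inter>i\<in>{1..m}. op_dom (B i))"
    and "X \<inter> common_sol_set m (\<lambda>i. point_op (D i) (A i)) B \<noteq> {}"
    and "0 < \<beta>min" and "\<beta>min \<le> \<beta>max" and "\<And>k. \<beta> k \<in> {\<beta>min..\<beta>max}"
    and "\<theta> \<in> {0<..<1}" and "\<delta> \<in> {0<..<1}" and "R > 0"
    and run: "algorithm_A m A B X \<beta> \<theta> \<delta> R x z J u"
    and no_stop: "\<And>k. stop_indices m z J k \<noteq> {1..m}"
  shows "\<exists>p \<in> common_sol_set m (\<lambda>i. point_op (D i) (A i)) B \<inter> X. x \<longlonglongrightarrow> p"
proof -
  let ?sol = "\<lambda>i. sol_set (point_op (D i) (A i)) (B i)"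
  let ?S = "common_sol_set m (\<lambda>i. point_op (D i) (A i)) B"
  note A = assms(2) and B = assms(3)
  have X: "closed X" "convex X" "\<And>i. i \<in> {1..m} \<Longrightarrow> X \<subseteq> op_dom (B i)"
    using assms(8-10) by auto
  have par: "\<theta> \<in> {0<..<1}" "\<delta> \<in> {0<..<1}" by fact+
  have \<beta>: "\<beta> k > 0" for k using assms(12) assms(14)[of k] by simp
  have XD: "X \<subseteq> D i" if "i \<in> {1..m}" for i using X(3)[OF that] A1[OF that] by blast
  have solS: "p \<in> ?sol i" if "p \<in> ?S" "i \<in> {1..m}" for p i
    using that by (auto simp: common_sol_set_def)
  obtain p0 where p0: "p0 \<in> X \<inter> ?S" using assms(11) by blast
  have x0: "x 0 \<in> X" and z1: "\<And>k. z k 1 = x k" and xS: "\<And>k. x (k + 1) = z k (m + 1)"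
    and J: "\<And>k i. i \<in> {1..m} \<Longrightarrow> J k i \<in> resolvent (\<beta> k) (B i) (z k i - \<beta> k *\<^sub>R A i (z k i))"
    and iter: "\<And>k i. i \<in> {1..m} \<Longrightarrow> if z k i = J k i then z k (i + 1) = z k i
      else inner_loop (A i) (B i) X (\<beta> k) \<theta> \<delta> R (z k i) (J k i) (u k i) (z k (i + 1))"
    using run unfolding algorithm_A_def by blast+
  \<comment> \<open>For a skipped index \<open>d = 0\<close> works, so both branches share one Fejer
    inequality; a cut is claimed only where the inner loop ran.\<close>
  have step: "z k (i + 1) \<in> X \<and> (\<exists>d. norm (z k (i + 1) - z k i) \<le> d \<and>
      (\<forall>p \<in> X \<inter> ?sol i. (norm (z k (i + 1) - p))\<^sup>2 \<le> (norm (z k i - p))\<^sup>2 - d\<^sup>2) \<and>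
      (z k i \<noteq> J k i \<longrightarrow> (\<exists>j. separating_cut (A i) (B i) (\<beta> k) \<theta> \<delta> R (z k i) (J k i) (u k i) j d)))"
    if i: "i \<in> {1..m}" and zX: "z k i \<in> X" for k i
  proof (cases "z k i = J k i")
    case True
    then show ?thesis using iter[OF i, of k] zX by (auto intro!: exI[of _ 0])
  next
    case False
    have "X \<inter> ?sol i \<noteq> {}" using p0 solS[OF _ i] by auto
    moreover have "inner_loop (A i) (B i) X (\<beta> k) \<theta> \<delta> R (z k i) (J k i) (u k i) (z k (i + 1))"
      using iter[OF i, of k] False by simp
    moreover have "\<delta> < 1" using par(2) by simp
    ultimately show ?thesis
      using inner_loop_separating_cut[OF A[OF i] B[OF i] A1[OF i] X(1,2) X(3)[OF i] zX False \<beta>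
          J[OF i] par(1)] by blast
  qed
  \<comment> \<open>The sweep starts at index \<open>1\<close>, hence \<open>Suc i\<close>.
    Membership of \<open>x k\<close> is a premise here because it is itself obtained from the end of
    the previous sweep, by induction on \<open>k\<close>.\<close>
  have zX_if: "z k (Suc i) \<in> X" if "x k \<in> X" "i \<le> m" for k i
    using that(2)
  proof (induction i)
    case 0
    then show ?case using z1 that(1) by simp
  next
    case (Suc i)
    then show ?case using step[of "Suc i" k] by simp
  qed
  have xX: "x k \<in> X" for k
    by (induction k) (use x0 xS zX_if[of _ m] in auto)
  have zX: "z k i \<in> X" if "i \<in> {1..m+1}" for k i
    using zX_if[OF xX, of "i - 1" k] that by auto
  have "\<exists>d. \<forall>k. \<forall>i\<in>{1..m}. norm (z k (i + 1) - z k i) \<le> d k i \<and>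
      (\<forall>p \<in> X \<inter> ?sol i. (norm (z k (i + 1) - p))\<^sup>2 \<le> (norm (z k i - p))\<^sup>2 - (d k i)\<^sup>2) \<and>
      (z k i \<noteq> J k i \<longrightarrow>
        (\<exists>j. separating_cut (A i) (B i) (\<beta> k) \<theta> \<delta> R (z k i) (J k i) (u k i) j (d k i)))"
    by (intro choice allI bchoice ballI) (use step zX in auto)
  then obtain d where d: "\<And>k i. i \<in> {1..m} \<Longrightarrow> norm (z k (i + 1) - z k i) \<le> d k i"
    and fejer: "\<And>k i p. i \<in> {1..m} \<Longrightarrow> p \<in> X \<Longrightarrow> p \<in> ?sol i \<Longrightarrow>
      (norm (z k (i + 1) - p))\<^sup>2 \<le> (norm (z k i - p))\<^sup>2 - (d k i)\<^sup>2"
    and cut: "\<And>k i. i \<in> {1..m} \<Longrightarrow> z k i \<noteq> J k i \<Longrightarrow>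
      \<exists>j. separating_cut (A i) (B i) (\<beta> k) \<theta> \<delta> R (z k i) (J k i) (u k i) j (d k i)"
    by blast
  have fejer_sum: "(norm (z k (Suc i) - p))\<^sup>2 \<le> (norm (x k - p))\<^sup>2 - (\<Sum>l=1..i. (d k l)\<^sup>2)"
    if "i \<le> m" "p \<in> X \<inter> ?S" for k i p
    using that(1)
  proof (induction i)
    case 0
    then show ?case using z1 by simp
  next
    case (Suc i)
    then show ?case using fejer[of "Suc i" p k] solS[of p "Suc i"] that(2) by simp
  qed
  have fejer_x: "(norm (x (Suc k) - p))\<^sup>2 \<le> (norm (x k - p))\<^sup>2 - (\<Sum>l=1..m. (d k l)\<^sup>2)"
    if "p \<in> X \<inter> ?S" for k p
    using fejer_sum[OF order_refl that, of k] xS[of k] by simp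
  have anti: "decseq (\<lambda>k. (norm (x k - p))\<^sup>2)" if "p \<in> X \<inter> ?S" for p
  proof (rule decseq_SucI)
    fix k
    have "(\<Sum>l=1..m. (d k l)\<^sup>2) \<ge> 0" by (simp add: sum_nonneg)
    then show "(norm (x (Suc k) - p))\<^sup>2 \<le> (norm (x k - p))\<^sup>2"
      using fejer_x[OF that, of k] by linarith
  qed
  obtain L where L: "(\<lambda>k. (norm (x k - p0))\<^sup>2) \<longlonglongrightarrow> L"
    using decseq_convergent[OF anti[OF p0], of 0] by auto
  \<comment> \<open>Each squared \<open>d k i\<close> is at most the decrease of the squared
    distance to \<open>p0\<close> over sweep \<open>k\<close>, a difference of consecutive terms of
    a convergent sequence.\<close>
  have dlim: "(\<lambda>k. d k i) \<longlonglongrightarrow> 0" if i: "i \<in> {1..m}" for i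
  proof -
    have "(\<lambda>k. (norm (x k - p0))\<^sup>2 - (norm (x (Suc k) - p0))\<^sup>2) \<longlonglongrightarrow> L - L"
      by (intro tendsto_intros L LIMSEQ_Suc[OF L])
    moreover have "(d k i)\<^sup>2 \<le> (norm (x k - p0))\<^sup>2 - (norm (x (Suc k) - p0))\<^sup>2" for k
      using fejer_x[OF p0, of k] member_le_sum[OF i, of "\<lambda>l. (d k l)\<^sup>2"] by auto
    ultimately have "(\<lambda>k. (d k i)\<^sup>2) \<longlonglongrightarrow> 0"
      by (intro tendsto_sandwich[of "\<lambda>_. 0" "\<lambda>k. (d k i)\<^sup>2"]) auto
    then have "(\<lambda>k. sqrt ((d k i)\<^sup>2)) \<longlonglongrightarrow> sqrt 0" by (rule tendsto_real_sqrt)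
    then show ?thesis by (simp add: tendsto_rabs_zero_iff)
  qed
  \<comment> \<open>Each point of a sweep is reached from \<open>x k\<close> by at most
    \<open>m\<close> vanishing steps, so along a subsequence it shares the limit of
    \<open>x\<close>.\<close>
  have gap: "(\<lambda>k. z k (Suc i) - x k) \<longlonglongrightarrow> 0" if "i \<le> m" for i
    using that
  proof (induction i)
    case 0
    then show ?case using z1 by simp
  next
    case (Suc i)
    then have i: "Suc i \<in> {1..m}" by simp
    have "(\<lambda>k. z k (Suc (Suc i)) - z k (Suc i)) \<longlonglongrightarrow> 0"
      by (rule Lim_null_comparison[OF _ dlim[OF i]]) (use d[OF i] in auto)
    from tendsto_add[OF this Suc.IH] Suc.prems show ?case by simp
  qed
  have "x k \<in> cball p0 (norm (x 0 - p0))" for k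
    using decseqD[OF anti[OF p0], of 0 k]
    by (simp add: dist_norm norm_minus_commute abs_le_square_iff[symmetric])
  then obtain x' r where r: "strict_mono (r :: nat \<Rightarrow> nat)" "(x \<circ> r) \<longlonglongrightarrow> x'"
    using compact_cball[of p0 "norm (x 0 - p0)"] unfolding compact_def by metis
  have xr: "(\<lambda>n. x (r n)) \<longlonglongrightarrow> x'" using r(2) by (simp add: o_def)
  have x'X: "x' \<in> X" by (rule closed_sequentially[OF X(1) _ xr]) (rule xX)
  have "x' \<in> ?sol i" if i: "i \<in> {1..m}" for i
  proof (rule cluster_point_mem_sol_set[OF A[OF i] B[OF i] A1[OF i]])
    have "i - 1 \<le> m" "Suc (i - 1) = i" using i by auto
    from gap[OF this(1), unfolded this(2)] have "(\<lambda>k. z k i - x k) \<longlonglongrightarrow> 0" .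
    from tendsto_add[OF LIMSEQ_subseq_LIMSEQ[OF this r(1), unfolded o_def] xr]
    show "(\<lambda>n. z (r n) i) \<longlonglongrightarrow> x'" by simp
    show "(\<lambda>n. d (r n) i) \<longlonglongrightarrow> 0"
      using LIMSEQ_subseq_LIMSEQ[OF dlim[OF i] r(1)] by (simp add: o_def)
    show "z (r n) i \<in> D i" for n using zX[of i "r n"] XD[OF i] i by auto
    show "x' \<in> D i" using x'X XD[OF i] by auto
    show "\<beta> (r n) \<in> {\<beta>min..\<beta>max}" for n by (rule assms(14))
    show "J (r n) i \<in> resolvent (\<beta> (r n)) (B i) (z (r n) i - \<beta> (r n) *\<^sub>R A i (z (r n) i))" for n
      by (rule J[OF i])
    show "p0 \<in> ?sol i" using p0 solS i by auto
    show "\<exists>j. separating_cut (A i) (B i) (\<beta> (r n)) \<theta> \<delta> R (z (r n) i) (J (r n) i) (u (r n) i) j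
        (d (r n) i)" if "z (r n) i \<noteq> J (r n) i" for n
      by (rule cut[OF i that])
  qed (use assms(12) par in auto)
  then have x'S: "x' \<in> X \<inter> ?S" using x'X by (simp add: common_sol_set_def)
  \<comment> \<open>The cluster point \<open>x'\<close> is now itself a solution in
    \<open>X\<close>, so the squared distances to it also decrease. Their limit is found along
    \<open>r\<close>, where it is \<open>0\<close>.\<close>
  obtain L' where L': "(\<lambda>k. (norm (x k - x'))\<^sup>2) \<longlonglongrightarrow> L'"
    using decseq_convergent[OF anti[OF x'S], of 0] by auto
  have "(\<lambda>n. (norm (x (r n) - x'))\<^sup>2) \<longlonglongrightarrow> (norm (x' - x'))\<^sup>2" by (intro tendsto_intros xr)
  moreover have "(\<lambda>n. (norm (x (r n) - x'))\<^sup>2) \<longlonglongrightarrow> L'"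
    using LIMSEQ_subseq_LIMSEQ[OF L' r(1)] by (simp add: o_def)
  ultimately have "L' = (norm (x' - x'))\<^sup>2" by (rule LIMSEQ_unique[rotated])
  then have "L' = 0" by simp
  then have "(\<lambda>k. sqrt ((norm (x k - x'))\<^sup>2)) \<longlonglongrightarrow> sqrt 0"
    using L' by (intro tendsto_real_sqrt) simp
  then have "(\<lambda>k. norm (x k - x')) \<longlonglongrightarrow> 0" by simp
  then have "x \<longlonglongrightarrow> x'" by (rule LIM_zero_cancel[OF tendsto_norm_zero_cancel])
  then show ?thesis using x'S by blast
qed

end
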